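(* Let $H$ be a tournament. If $H$ is not a tournament forest, then there is a constant $c=c(H)>0$ such that $$t(n,H)\ge t(T_n,H)\ge \Omega(n^{1+c})$$ as $n\to\infty$. Moreover, for every $\epsilon>0$ there is a tournament $H$ with $\chi(H)=2$ satisfying $t(T_n,H)=\Omega(n^{2-\epsilon})$.
   Context: A tournament is a digraph having exactly one of the edges $(u,v),(v,u)$ for every pair of distinct vertices $u,v$. A set of vertices of a tournament is transitive if the sub-tournament it induces has no directed cycle. $T_n$ is the transitive tournament on $n$ vertices. The chromatic number $\chi(H)$ is the minimum $k$ such that $V(H)$ can be partitioned into $k$ transitive sets. A tournament $H$ is a tournament forest if its vertex set can be partitioned into two transitive sets $L,R$ such that the undirected bipartite graph on $L$ and $R$ in which $\ell\in L$ is adjacent to $r\in R$ if and only if $H$ has the edge $(r,\ell)$ (pointing from $r$ to $\ell$) is a forest. Adding an edge to a tournament means adding the reverse $(v,u)$ of some existing edge $(u,v)$. A digraph contains a copy of $H$ if it has a (not necessarily induced) subgraph isomorphic to $H$. For $n\ge |V(H)|$: $t(n,H)$ is the smallest integer $t$ such that adding any $t$ edges to any $n$-vertex tournament results in a digraph containing a copy of $H$; $t(T_n,H)$ is the smallest integer $t$ such that adding any $t$ edges to $T_n$ results in a digraph containing a copy of $H$. Implied constants in $\Omega(\cdot)$ may depend on $H$ but not on $n$. *)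

theory Defs
  imports
    "Graph_Theory.Graph_Theory"
    "HOL-Library.Disjoint_Sets"
    "HOL-Library.Landau_Symbols"
begin

locale tournament = pair_digraph G for G :: "'a pair_pre_digraph" +
  assumes exactly_one_arc:
    "u \<in> pverts G \<Longrightarrow> v \<in> pverts G \<Longrightarrow> u \<noteq> v \<Longrightarrow> (u, v) \<in> parcs G \<longleftrightarrow> (v, u) \<notin> parcs G"

definition transitive_set :: "'a pair_pre_digraph \<Rightarrow> 'a set \<Rightarrow> bool" where
  "transitive_set G S \<longleftrightarrow>
     S \<subseteq> pverts G \<and> \<not> (\<exists>p. pre_digraph.cycle (with_proj G \<restriction> S) p)"

definition transitive_tournament :: "nat \<Rightarrow> nat pair_pre_digraph" where
  "transitive_tournament n = \<lparr> pverts = {..<n}, parcs = {(i, j). i < j \<and> j < n} \<rparr>"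

definition chromatic_number :: "'a pair_pre_digraph \<Rightarrow> nat" where
  "chromatic_number H =
     (LEAST k. \<exists>P. partition_on (pverts H) P \<and> card P = k \<and> (\<forall>S\<in>P. transitive_set H S))"

text \<open>
  Undirected graphs are represented as symmetric digraphs. There a single edge already gives the
  closed walk \<open>u, v, u\<close>, which counts as a directed cycle; the cycles of an undirected simple graph
  are those of length at least three. (The constant \<^const>\<open>forest\<close> forbids all directed cycles and
  so is not the notion wanted here.)
\<close>
definition undirected_forest :: "'a pair_pre_digraph \<Rightarrow> bool" where
  "undirected_forest G \<longleftrightarrow> \<not> (\<exists>p. pre_digraph.cycle (with_proj G) p \<and> 3 \<le> length p)"

definition back_edge_graph ::
    "'a pair_pre_digraph \<Rightarrow> 'a set \<Rightarrow> 'a set \<Rightarrow> 'a pair_pre_digraph" where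
  "back_edge_graph H L R =
     \<lparr> pverts = L \<union> R,
       parcs = (\<Union>l\<in>L. \<Union>r\<in>R. if (r, l) \<in> parcs H then {(l, r), (r, l)} else {}) \<rparr>"

text \<open>Either of the two parts may be empty, so that the one-vertex tournament is a tournament forest.\<close>
definition tournament_forest :: "'a pair_pre_digraph \<Rightarrow> bool" where
  "tournament_forest H \<longleftrightarrow> tournament H \<and>
     (\<exists>L R. L \<union> R = pverts H \<and> L \<inter> R = {} \<and> transitive_set H L \<and> transitive_set H R \<and>
            undirected_forest (back_edge_graph H L R))"

definition contains_copy :: "'b pair_pre_digraph \<Rightarrow> 'a pair_pre_digraph \<Rightarrow> bool" where
  "contains_copy G H \<longleftrightarrow>
     (\<exists>K :: 'b pair_pre_digraph. subgraph (with_proj K) (with_proj G) \<and>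
                               digraph_iso (with_proj H) (with_proj K))"

definition add_edges :: "'a pair_pre_digraph \<Rightarrow> ('a \<times> 'a) set \<Rightarrow> 'a pair_pre_digraph" where
  "add_edges G S = \<lparr> pverts = pverts G, parcs = parcs G \<union> S \<rparr>"

definition adding_forces ::
    "'b pair_pre_digraph \<Rightarrow> nat \<Rightarrow> 'a pair_pre_digraph \<Rightarrow> bool" where
  "adding_forces G t H \<longleftrightarrow>
     (\<forall>S. S \<subseteq> (parcs G)\<inverse> \<and> card S = t \<longrightarrow> contains_copy (add_edges G S) H)"

text \<open>
  The two thresholds are meant for \<open>n \<ge> card (pverts H)\<close>. Up to isomorphism every \<open>n\<close>-vertex
  tournament has its vertices among the natural numbers. The least element always exists, since no
  set of more than \<open>n choose 2\<close> reversed edges is available.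
\<close>
definition turan_tournament :: "nat \<Rightarrow> 'a pair_pre_digraph \<Rightarrow> nat" where
  "turan_tournament n H =
     (LEAST t. \<forall>G :: nat pair_pre_digraph. tournament G \<and> card (pverts G) = n \<longrightarrow>
                 adding_forces G t H)"

definition turan_transitive :: "nat \<Rightarrow> 'a pair_pre_digraph \<Rightarrow> nat" where
  "turan_transitive n H = (LEAST t. adding_forces (transitive_tournament n) t H)"

end

theory Submission
  imports Defs
begin

text \<open>
  Cut the vertices of the transitive tournament into a lower and an upper half and add the reverses of a set
  \<open>S\<close> of arcs from the lower to the upper half. In a copy of a tournament \<open>H\<close> in the resulting digraph, the
  vertices in the lower half form a transitive set \<open>L\<close>, those in the upper half a transitive set \<open>R\<close>, and every
  arc of \<open>H\<close> from \<open>R\<close> to \<open>L\<close> is an added edge (\<open>copy_embeds_back_arcs\<close>). So the back-edge graph of \<open>L\<close> and \<open>R\<close>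
  is a subgraph of \<open>S\<close>, and \<open>t(T\<^sub>n, H)\<close> exceeds the size of every bipartite graph \<open>S\<close> that contains none of the
  back-edge graphs of \<open>H\<close>.

  Such graphs with many edges come from the deletion method: for every \<open>\<theta> > 0\<close> and \<open>h\<close> there are bipartite graphs
  with at least \<open>c * n powr (2 - \<theta>)\<close> edges, for a constant \<open>c > 0\<close>, in which every subgraph with at most \<open>h\<close>
  vertices and at least two edges is sparse, in the sense that \<open>v\<close> vertices and \<open>k\<close> edges satisfy
  \<open>\<theta> * (k - 1) < v - 2\<close> (\<open>sparse_bipartite_graph\<close>). It remains to find in the back-edge graphs of \<open>H\<close> a subgraph
  that is not sparse.

  If \<open>H\<close> is not a tournament forest, each of its back-edge graphs has a cycle, and a cycle of length at most \<open>h\<close>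
  is not sparse for \<open>\<theta> = 1 - 1 / h\<close>. For the second claim \<open>H\<close> is a cyclic triangle whose vertices are blown up to
  transitive tournaments on \<open>2 * s\<close> vertices. A transitive set misses one of the three blocks, and from this every
  back-edge graph contains a complete bipartite graph with parts of size \<open>s\<close> (\<open>blown_up_triangle_biclique\<close>),
  which is not sparse for any \<open>\<theta> \<ge> 2 / (s + 1)\<close> when \<open>s \<ge> 2\<close>.

  The comparison \<open>t(n, H) \<ge> t(T\<^sub>n, H)\<close> holds because the transitive tournament is one of the tournaments over
  which \<open>t(n, H)\<close> ranges.
\<close>

section \<open>The deletion method\<close>

text \<open>
  The number of maps into \<open>{..<q}\<close> that vanish on \<open>K\<close> is what makes the zero set of a uniformly random
  map a random subset of \<open>E\<close> containing each element independently with probability \<open>1 / q\<close>. Counting maps in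
  this way replaces a probability space.
\<close>

lemma card_maps_vanishing_on:
  assumes "finite E" "K \<subseteq> E" "q > 0"
  shows "card {f \<in> E \<rightarrow>\<^sub>E {..<q}. \<forall>e\<in>K. f e = 0} = q ^ (card E - card K)"
proof -
  have "{f \<in> E \<rightarrow>\<^sub>E {..<q}. \<forall>e\<in>K. f e = 0} = (\<Pi>\<^sub>E e\<in>E. if e \<in> K then {0} else {..<q})"
    using assms by (fastforce simp: PiE_iff extensional_def split: if_splits)
  then have "card {f \<in> E \<rightarrow>\<^sub>E {..<q}. \<forall>e\<in>K. f e = 0} =
      (\<Prod>e\<in>E. card (if e \<in> K then {0} else {..<q}))"
    using assms(1) by (simp add: card_PiE)
  also have "\<dots> = (\<Prod>e\<in>E - K. q)"
    using assms by (intro prod.mono_neutral_cong_right) auto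
  also have "\<dots> = q ^ (card E - card K)"
    using assms by (simp add: card_Diff_subset finite_subset)
  finally show ?thesis .
qed

text \<open>
  For a random subset \<open>A\<close> of \<open>E\<close> of density \<open>1 / q\<close>, the expected size of \<open>A\<close> minus the expected number of
  members of \<open>\<F>\<close> inside \<open>A\<close> is at least \<open>card E / q - card E / (2 * q)\<close>. Some outcome does at least as well
  as the expectation, and deleting one element from each member of \<open>\<F>\<close> inside it leaves the set \<open>S\<close>.
\<close>

lemma deletion_method:
  fixes E :: "'e set" and \<F> :: "'e set set" and q :: nat
  assumes "finite E" and \<F>: "\<And>K. K \<in> \<F> \<Longrightarrow> K \<subseteq> E \<and> K \<noteq> {}" and "q > 0"
    and few: "(\<Sum>K\<in>\<F>. 1 / real q ^ card K) \<le> real (card E) / (2 * real q)"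
  shows "\<exists>S\<subseteq>E. real (card E) / (2 * real q) \<le> real (card S) \<and> (\<forall>K\<in>\<F>. \<not> K \<subseteq> S)"
proof -
  define \<Omega> where "\<Omega> = E \<rightarrow>\<^sub>E {..<q}"
  define A where "A f = {e \<in> E. f e = 0}" for f :: "'e \<Rightarrow> nat"
  define B where "B f = {K \<in> \<F>. K \<subseteq> A f}" for f
  have fin\<Omega>: "finite \<Omega>" and card\<Omega>: "card \<Omega> = q ^ card E"
    using \<open>finite E\<close> by (auto simp: \<Omega>_def finite_PiE card_PiE)
  have fin\<F>: "finite \<F>"
    using \<open>finite E\<close> \<F> by (intro finite_subset[of \<F> "Pow E"]) auto
  have prob: "real (card {f \<in> \<Omega>. K \<subseteq> A f}) = real (card \<Omega>) * (1 / real q ^ card K)" if "K \<subseteq> E" for K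
  proof -
    have "{f \<in> \<Omega>. K \<subseteq> A f} = {f \<in> \<Omega>. \<forall>e\<in>K. f e = 0}"
      using that by (auto simp: A_def)
    moreover have "card K \<le> card E"
      using that \<open>finite E\<close> by (rule card_mono[rotated])
    ultimately have "real (card {f \<in> \<Omega>. K \<subseteq> A f}) = real q ^ (card E - card K)"
      using card_maps_vanishing_on[OF \<open>finite E\<close> that \<open>q > 0\<close>] by (simp add: \<Omega>_def)
    also have "\<dots> = real (card \<Omega>) * (1 / real q ^ card K)"
      using \<open>card K \<le> card E\<close> \<open>q > 0\<close> by (simp add: card\<Omega> power_diff)
    finally show ?thesis .
  qed
  \<comment> \<open>\<open>EA\<close> and \<open>EB\<close> are the two expectations, scaled by the number of maps.\<close>
  have EA: "(\<Sum>f\<in>\<Omega>. real (card (A f))) = real (card \<Omega>) * (real (card E) / real q)"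
  proof -
    have "(\<Sum>f\<in>\<Omega>. real (card (A f))) = (\<Sum>f\<in>\<Omega>. \<Sum>e\<in>E. if e \<in> A f then 1 else 0)"
      using \<open>finite E\<close> by (intro sum.cong refl) (simp add: A_def sum.If_cases Int_def)
    also have "\<dots> = (\<Sum>e\<in>E. \<Sum>f\<in>\<Omega>. if e \<in> A f then 1 else 0)"
      by (rule sum.swap)
    also have "\<dots> = (\<Sum>e\<in>E. real (card {f \<in> \<Omega>. {e} \<subseteq> A f}))"
      using fin\<Omega> by (intro sum.cong refl) (simp add: sum.If_cases Int_def)
    also have "\<dots> = (\<Sum>e\<in>E. real (card \<Omega>) * (1 / real q))"
      using prob[of "{_}"] by (intro sum.cong refl) simp
    finally show ?thesis by simp
  qed
  have EB: "(\<Sum>f\<in>\<Omega>. real (card (B f))) = real (card \<Omega>) * (\<Sum>K\<in>\<F>. 1 / real q ^ card K)"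
  proof -
    have "(\<Sum>f\<in>\<Omega>. real (card (B f))) = (\<Sum>f\<in>\<Omega>. \<Sum>K\<in>\<F>. if K \<subseteq> A f then 1 else 0)"
      using fin\<F> by (intro sum.cong refl) (simp add: B_def sum.If_cases Int_def)
    also have "\<dots> = (\<Sum>K\<in>\<F>. \<Sum>f\<in>\<Omega>. if K \<subseteq> A f then 1 else 0)"
      by (rule sum.swap)
    also have "\<dots> = (\<Sum>K\<in>\<F>. real (card {f \<in> \<Omega>. K \<subseteq> A f}))"
      using fin\<Omega> by (intro sum.cong refl) (simp add: sum.If_cases Int_def)
    also have "\<dots> = (\<Sum>K\<in>\<F>. real (card \<Omega>) * (1 / real q ^ card K))"
      using prob \<F> by (intro sum.cong refl) blast
    finally show ?thesis by (simp add: sum_distrib_left)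
  qed
  obtain f where f: "f \<in> \<Omega>" "real (card E) / (2 * real q) \<le> real (card (A f)) - real (card (B f))"
  proof (rule ccontr)
    assume "\<not> thesis"
    then have "\<forall>f\<in>\<Omega>. real (card (A f)) - real (card (B f)) < real (card E) / (2 * real q)"
      using that by force
    moreover have "\<Omega> \<noteq> {}"
      using card\<Omega> \<open>q > 0\<close> by auto
    ultimately have "(\<Sum>f\<in>\<Omega>. real (card (A f)) - real (card (B f))) <
        (\<Sum>f\<in>\<Omega>. real (card E) / (2 * real q))"
      using fin\<Omega> by (intro sum_strict_mono) auto
    also have "\<dots> = real (card \<Omega>) * (real (card E) / real q) -
        real (card \<Omega>) * (real (card E) / (2 * real q))"
      by (simp add: field_simps)
    also have "\<dots> \<le> real (card \<Omega>) * (real (card E) / real q) -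
        real (card \<Omega>) * (\<Sum>K\<in>\<F>. 1 / real q ^ card K)"
      by (intro diff_left_mono mult_left_mono few) simp
    also have "\<dots> = (\<Sum>f\<in>\<Omega>. real (card (A f)) - real (card (B f)))"
      by (simp add: sum_subtractf EA EB)
    finally show False by simp
  qed
  have "\<forall>K\<in>\<F>. \<exists>e. e \<in> K"
    using \<F> by auto
  then obtain pick where pick: "\<And>K. K \<in> \<F> \<Longrightarrow> pick K \<in> K"
    by metis
  let ?S = "A f - pick ` B f"
  have "finite (B f)" "finite (A f)"
    using fin\<F> \<open>finite E\<close> by (auto simp: B_def A_def)
  then have "card (A f) \<le> card ?S + card (B f)"
    by (smt (verit) card_image_le diff_card_le_card_Diff finite_imageI le_diff_conv le_trans add.commute add_le_mono)
  then have "real (card E) / (2 * real q) \<le> real (card ?S)"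
    using f(2) by linarith
  moreover have "\<not> K \<subseteq> ?S" if "K \<in> \<F>" for K
    using pick[OF that] that by (auto simp: B_def)
  moreover have "?S \<subseteq> E"
    by (auto simp: A_def)
  ultimately show ?thesis by blast
qed

section \<open>Locally sparse bipartite graphs\<close>

lemma card_relations_with_Field_card:
  fixes n v :: nat
  shows "card {K. K \<subseteq> {..<n} \<times> {..<n} \<and> card (Field K) = v} \<le> n ^ v * 2 ^ (v * v)"
proof -
  let ?V = "{V. V \<subseteq> {..<n} \<and> card V = v}"
  have fin: "finite ?V"
    by (rule finite_subset[of _ "Pow {..<n}"]) auto
  have finV: "finite V" if "V \<in> ?V" for V
    using that finite_subset by fastforce
  have "{K. K \<subseteq> {..<n} \<times> {..<n} \<and> card (Field K) = v} \<subseteq> (\<Union>V\<in>?V. Pow (V \<times> V))"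
  proof
    fix K assume "K \<in> {K. K \<subseteq> {..<n} \<times> {..<n} \<and> card (Field K) = v}"
    then have "Field K \<in> ?V" "K \<subseteq> Field K \<times> Field K"
      by (auto simp: Field_def)
    then show "K \<in> (\<Union>V\<in>?V. Pow (V \<times> V))" by blast
  qed
  moreover have "finite (\<Union>V\<in>?V. Pow (V \<times> V))"
    using fin finV by blast
  ultimately have "card {K. K \<subseteq> {..<n} \<times> {..<n} \<and> card (Field K) = v} \<le> card (\<Union>V\<in>?V. Pow (V \<times> V))"
    by (rule card_mono[rotated])
  also have "\<dots> \<le> (\<Sum>V\<in>?V. card (Pow (V \<times> V)))"
    by (rule card_UN_le[OF fin])
  also have "\<dots> = (\<Sum>V\<in>?V. 2 ^ (v * v))"
    using finV by (intro sum.cong refl) (auto simp: card_Pow card_cartesian_product)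
  also have "\<dots> = (n choose v) * 2 ^ (v * v)"
    using n_subsets[of "{..<n}" v] by simp
  also have "\<dots> \<le> n ^ v * 2 ^ (v * v)"
  proof (cases "v \<le> n")
    case True
    then show ?thesis by (intro mult_right_mono binomial_le_pow) auto
  qed (simp add: binomial_eq_0)
  finally show ?thesis .
qed

text \<open>
  There are at most \<open>n ^ v\<close> vertex sets of size \<open>v\<close>, each carrying at most \<open>2 ^ (v * v)\<close> relations; the weight
  \<open>1 / n ^ v\<close> cancels the first factor and leaves a bound independent of \<open>n\<close>.
\<close>

lemma sum_inverse_power_card_Field_le:
  fixes n h :: nat
  assumes "n > 0"
  shows "(\<Sum>K | K \<subseteq> {..<n} \<times> {..<n} \<and> card (Field K) \<le> h. 1 / real n ^ card (Field K))
    \<le> real (h + 1) * 2 ^ (h * h)" (is "sum ?g ?F \<le> _")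
proof -
  have fin: "finite ?F"
    by (rule finite_subset[of _ "Pow ({..<n} \<times> {..<n})"]) auto
  have "sum ?g ?F = (\<Sum>v\<le>h. \<Sum>K | K \<in> ?F \<and> card (Field K) = v. ?g K)"
    using fin by (intro sum.group[symmetric]) auto
  also have "\<dots> \<le> (\<Sum>v\<le>h. 2 ^ (h * h))"
  proof (intro sum_mono)
    fix v assume "v \<in> {..h}"
    have "{K. K \<in> ?F \<and> card (Field K) = v} = {K. K \<subseteq> {..<n} \<times> {..<n} \<and> card (Field K) = v}"
      using \<open>v \<in> {..h}\<close> by auto
    then have "(\<Sum>K | K \<in> ?F \<and> card (Field K) = v. ?g K) =
        real (card {K. K \<subseteq> {..<n} \<times> {..<n} \<and> card (Field K) = v}) / real n ^ v"
      by simp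
    also have "\<dots> \<le> real (n ^ v * 2 ^ (v * v)) / real n ^ v"
      by (intro divide_right_mono of_nat_mono card_relations_with_Field_card) simp
    also have "\<dots> = 2 ^ (v * v)"
      using assms by simp
    also have "\<dots> \<le> 2 ^ (h * h)"
      using \<open>v \<in> {..h}\<close> by (intro power_increasing mult_mono) auto
    finally show "(\<Sum>K | K \<in> ?F \<and> card (Field K) = v. ?g K) \<le> 2 ^ (h * h)" .
  qed
  finally show ?thesis by simp
qed

text \<open>
  A random bipartite graph of edge density about \<open>n powr - \<theta>\<close> has about \<open>n powr (2 - \<theta>)\<close> edges, and a graph with
  \<open>v\<close> vertices and \<open>k\<close> edges is expected to occur about \<open>n powr (v - \<theta> * k)\<close> times. If \<open>v - 2 \<le> \<theta> * (k - 1)\<close>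
  then these copies are no more numerous than the edges, so (with a suitable constant in the density) all of
  them can be destroyed by deleting at most half of the edges. Short cycles and complete bipartite graphs are
  both excluded by the one condition on \<open>v\<close> and \<open>k\<close>.
\<close>

lemma sparse_bipartite_graph:
  fixes \<theta> :: real and h :: nat
  assumes "\<theta> > 0"
  shows "\<exists>c>0. \<forall>n\<ge>2. \<exists>S \<subseteq> {..<n div 2} \<times> {n div 2..<n}.
    c * real n powr (2 - \<theta>) \<le> real (card S) \<and>
    (\<forall>K\<subseteq>S. 2 \<le> card K \<longrightarrow> card (Field K) \<le> h \<longrightarrow>
       \<theta> * (real (card K) - 1) < real (card (Field K)) - 2)"
proof -
  \<comment> \<open>The factor \<open>16\<close> pays for \<open>card E \<ge> n\<^sup>2 / 8\<close> and for keeping half of the edges.\<close>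
  define W :: real where "W = real (h + 1) * 2 ^ (h * h)"
  define C where "C = 16 * W"
  have "1 * 1 \<le> W"
    unfolding W_def by (intro mult_mono) auto
  then have W: "W \<ge> 1" and C: "C \<ge> 1"
    by (simp_all add: C_def)
  have "\<exists>S \<subseteq> {..<n div 2} \<times> {n div 2..<n}.
      1 / (32 * C) * real n powr (2 - \<theta>) \<le> real (card S) \<and>
      (\<forall>K\<subseteq>S. 2 \<le> card K \<longrightarrow> card (Field K) \<le> h \<longrightarrow>
         \<theta> * (real (card K) - 1) < real (card (Field K)) - 2)" if n: "n \<ge> 2" for n :: nat
  proof -
    define E where "E = {..<n div 2} \<times> {n div 2..<n}"
    define \<F> where "\<F> = {K. K \<subseteq> E \<and> 2 \<le> card K \<and> card (Field K) \<le> h \<and>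
      real (card (Field K)) - 2 \<le> \<theta> * (real (card K) - 1)}"
    define q where "q = nat \<lceil>C * real n powr \<theta>\<rceil>"
    have n\<theta>: "real n powr \<theta> \<ge> 1"
      using n assms by (intro ge_one_powr_ge_zero) auto
    have "1 * 1 \<le> C * real n powr \<theta>"
      using C n\<theta> by (intro mult_mono) auto
    then have q: "C * real n powr \<theta> \<le> real q" "real q \<le> 2 * C * real n powr \<theta>" "q > 0"
      unfolding q_def by linarith+
    have cardE: "real n ^ 2 / 8 \<le> real (card E)"
    proof -
      have "real (n div 2) \<ge> real n / 4" "real (n - n div 2) \<ge> real n / 2"
        using n by linarith+
      then have "real n / 4 * (real n / 2) \<le> real (n div 2) * real (n - n div 2)"
        by (intro mult_mono) auto
      then show ?thesis
        by (simp add: E_def card_cartesian_product power2_eq_square)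
    qed
    have weight: "1 / real q ^ card K \<le> real n ^ 2 / (C * real q) * (1 / real n ^ card (Field K))"
      if "K \<in> \<F>" for K
    proof -
      have k: "card K = Suc (card K - 1)" "card K - 1 \<ge> 1"
        using that by (auto simp: \<F>_def)
      have "real n powr (real (card (Field K)) - 2) \<le> real n powr (\<theta> * real (card K - 1))"
        using that n k by (intro powr_mono) (auto simp: \<F>_def of_nat_diff)
      also have "\<dots> = (real n powr \<theta>) ^ (card K - 1)"
        using n by (simp add: powr_powr[symmetric] powr_realpow)
      finally have "C ^ 1 * real n powr (real (card (Field K)) - 2) \<le>
          C ^ (card K - 1) * (real n powr \<theta>) ^ (card K - 1)"
        using C k(2) by (intro mult_mono power_increasing) auto
      also have "\<dots> = (C * real n powr \<theta>) ^ (card K - 1)"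
        by (simp add: power_mult_distrib)
      also have "\<dots> \<le> real q ^ (card K - 1)"
        using q C by (intro power_mono) auto
      finally have *: "C * (real n ^ card (Field K) / real n ^ 2) \<le> real q ^ (card K - 1)"
        using n by (simp add: powr_diff powr_realpow powr_numeral)
      have "1 / real q ^ card K = 1 / (real q * real q ^ (card K - 1))"
        by (subst k(1)) simp
      also have "\<dots> \<le> 1 / (real q * (C * (real n ^ card (Field K) / real n ^ 2)))"
        using * q C n by (intro divide_left_mono mult_left_mono mult_pos_pos divide_pos_pos) auto
      finally show ?thesis
        by (simp add: field_simps)
    qed
    have "(\<Sum>K\<in>\<F>. 1 / real q ^ card K) \<le>
        (\<Sum>K\<in>\<F>. real n ^ 2 / (C * real q) * (1 / real n ^ card (Field K)))"
      by (intro sum_mono weight)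
    also have "\<dots> \<le> real n ^ 2 / (C * real q) * W"
    proof -
      have "(\<Sum>K\<in>\<F>. 1 / real n ^ card (Field K)) \<le>
          (\<Sum>K | K \<subseteq> {..<n} \<times> {..<n} \<and> card (Field K) \<le> h. 1 / real n ^ card (Field K))"
      proof (rule sum_mono2)
        show "finite {K. K \<subseteq> {..<n} \<times> {..<n} \<and> card (Field K) \<le> h}"
          by (rule finite_subset[of _ "Pow ({..<n} \<times> {..<n})"]) auto
        have "E \<subseteq> {..<n} \<times> {..<n}"
          by (auto simp: E_def)
        then show "\<F> \<subseteq> {K. K \<subseteq> {..<n} \<times> {..<n} \<and> card (Field K) \<le> h}"
          by (auto simp: \<F>_def)
      qed auto
      also have "\<dots> \<le> W"
        unfolding W_def using n by (intro sum_inverse_power_card_Field_le) simp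
      finally show ?thesis
        unfolding sum_distrib_left[symmetric] using C q by (intro mult_left_mono) auto
    qed
    also have "\<dots> = (real n ^ 2 / 8) / (2 * real q)"
      using W q by (simp add: C_def)
    also have "\<dots> \<le> real (card E) / (2 * real q)"
      using cardE by (intro divide_right_mono) auto
    finally have few: "(\<Sum>K\<in>\<F>. 1 / real q ^ card K) \<le> real (card E) / (2 * real q)" .
    obtain S where S: "S \<subseteq> E" "real (card E) / (2 * real q) \<le> real (card S)" "\<forall>K\<in>\<F>. \<not> K \<subseteq> S"
    proof -
      have "finite E" by (simp add: E_def)
      moreover have "\<And>K. K \<in> \<F> \<Longrightarrow> K \<subseteq> E \<and> K \<noteq> {}" by (auto simp: \<F>_def)
      ultimately show ?thesis
        using deletion_method[OF _ _ \<open>q > 0\<close> few] that by blast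
    qed
    have "1 / (32 * C) * real n powr (2 - \<theta>) = (real n ^ 2 / 8) / (2 * (2 * C * real n powr \<theta>))"
      using n by (simp add: powr_diff powr_numeral)
    also have "\<dots> \<le> real (card E) / (2 * real q)"
      using cardE q C by (intro frac_le) auto
    also note S(2)
    finally have "1 / (32 * C) * real n powr (2 - \<theta>) \<le> real (card S)" .
    moreover have "\<theta> * (real (card K) - 1) < real (card (Field K)) - 2"
      if "K \<subseteq> S" "2 \<le> card K" "card (Field K) \<le> h" for K
    proof (rule ccontr)
      assume "\<not> ?thesis"
      moreover have "K \<subseteq> E"
        using that(1) S(1) by (rule subset_trans)
      ultimately have "K \<in> \<F>"
        using that by (simp add: \<F>_def not_less)
      with S(3) that(1) show False by blast
    qed
    ultimately show ?thesis
      using S(1) unfolding E_def by blast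
  qed
  then show ?thesis
    using C by (intro exI[of _ "1 / (32 * C)"]) auto
qed

section \<open>Cycles and transitive sets\<close>

lemma cycle_with_proj_iff:
  "pre_digraph.cycle (with_proj G) p \<longleftrightarrow>
    (\<exists>u \<in> pverts G. set p \<subseteq> parcs G \<and> pcas u p u \<and> distinct (map snd p) \<and> p \<noteq> [])"
proof -
  have "pawalk_verts u p = u # map snd p" if "pcas u p v" for u v
    using that by (induction p arbitrary: u) auto
  then show ?thesis
    by (auto simp: pre_digraph.cycle_def pre_digraph.awalk_def cas_with_proj_eq
        awalk_verts_with_proj_eq)
qed

lemma with_proj_induce_subgraph:
  "with_proj G \<restriction> S = with_proj \<lparr>pverts = S, parcs = {(x, y) \<in> parcs G. x \<in> S \<and> y \<in> S}\<rparr>"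
  by (auto simp: induce_subgraph_def with_proj_def)

lemma transitive_set_iff:
  "transitive_set G S \<longleftrightarrow> S \<subseteq> pverts G \<and>
    \<not> (\<exists>p. \<exists>u\<in>S. set p \<subseteq> parcs G \<inter> S \<times> S \<and> pcas u p u \<and> distinct (map snd p) \<and> p \<noteq> [])"
  unfolding transitive_set_def with_proj_induce_subgraph cycle_with_proj_iff
  by (intro arg_cong2[where f="(\<and>)"] refl arg_cong[where f=Not] ex_cong1) auto

text \<open>
  A potential that increases along every arc cannot return to its initial value along a cycle.
\<close>

lemma transitive_setI:
  fixes \<phi> :: "'a \<Rightarrow> 'b::order"
  assumes "S \<subseteq> pverts G"
    and incr: "\<And>x y. x \<in> S \<Longrightarrow> y \<in> S \<Longrightarrow> (x, y) \<in> parcs G \<Longrightarrow> \<phi> x < \<phi> y"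
  shows "transitive_set G S"
proof -
  have "\<phi> u < \<phi> v" if "pcas u p v" "p \<noteq> []" "set p \<subseteq> parcs G \<inter> S \<times> S" for u p v
    using that
  proof (induction p arbitrary: u)
    case (Cons e p)
    then have "\<phi> u < \<phi> (snd e)"
      using incr[of "fst e" "snd e"] by auto
    with Cons show ?case
      by (cases "p = []") (auto intro: less_trans)
  qed simp
  then show ?thesis
    using assms(1) unfolding transitive_set_iff by blast
qed

lemma transitive_set_no_triangle:
  assumes "transitive_set G S" "x \<in> S" "y \<in> S" "z \<in> S" "x \<noteq> y" "y \<noteq> z" "z \<noteq> x"
    and "(x, y) \<in> parcs G" "(y, z) \<in> parcs G" "(z, x) \<in> parcs G"
  shows False
proof -
  have "set [(x, y), (y, z), (z, x)] \<subseteq> parcs G \<inter> S \<times> S" "pcas x [(x, y), (y, z), (z, x)] x"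
    "distinct (map snd [(x, y), (y, z), (z, x)])"
    using assms by auto
  then show False
    using assms(1,2) unfolding transitive_set_iff by blast
qed

lemma mset_tails_eq_mset_heads:
  "pcas u p v \<Longrightarrow> add_mset v (mset (map fst p)) = add_mset u (mset (map snd p))"
  by (induction p arbitrary: u) (auto simp: add_mset_commute)

lemma closed_set_absorbs_walk:
  assumes "pcas u p v" and "\<And>x y. (x, y) \<in> set p \<Longrightarrow> x \<in> A \<longleftrightarrow> y \<in> A"
  shows "\<forall>(x, y)\<in>set p. x \<in> A \<longleftrightarrow> u \<in> A"
  using assms
proof (induction p arbitrary: u)
  case (Cons e p)
  then have "\<forall>(x, y)\<in>set p. x \<in> A \<longleftrightarrow> snd e \<in> A"
    by simp
  moreover have "snd e \<in> A \<longleftrightarrow> u \<in> A"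
    using Cons.prems by (cases e) auto
  ultimately show ?case
    using Cons.prems by auto
qed simp

text \<open>
  Every vertex of a cycle has exactly one outgoing and one incoming arc on it. If both \<open>(x, y)\<close> and \<open>(y, x)\<close>
  occur, then no arc of the cycle enters or leaves \<open>{x, y}\<close>, so the whole cycle lives on two vertices. Hence a
  cycle of length at least three in a symmetric digraph uses as many undirected edges as it has arcs.
\<close>

lemma cycle_no_opposite_arcs:
  assumes p: "pcas u p u" "distinct (map snd p)" "3 \<le> length p"
    and xy: "(x, y) \<in> set p" "(y, x) \<in> set p"
  shows False
proof -
  have "mset (map fst p) = mset (map snd p)"
    using mset_tails_eq_mset_heads[OF p(1)] by simp
  then have dist: "distinct (map fst p)"
    using p(2) by (metis mset_eq_imp_distinct_iff)
  have tails: "e = e'" if "e \<in> set p" "e' \<in> set p" "fst e = fst e'" for e e'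
    using dist that by (auto simp: distinct_map dest: inj_onD)
  have heads: "e = e'" if "e \<in> set p" "e' \<in> set p" "snd e = snd e'" for e e'
    using p(2) that by (auto simp: distinct_map dest: inj_onD)
  have "a \<in> {x, y} \<longleftrightarrow> b \<in> {x, y}" if "(a, b) \<in> set p" for a b
    using tails[OF that xy(1)] tails[OF that xy(2)] heads[OF that xy(1)] heads[OF that xy(2)]
    unfolding fst_conv snd_conv prod.inject by blast
  then have closed: "\<forall>(a, b)\<in>set p. a \<in> {x, y} \<longleftrightarrow> u \<in> {x, y}"
    by (rule closed_set_absorbs_walk[OF p(1)])
  then have "u \<in> {x, y}"
    using xy by fastforce
  then have "set (map fst p) \<subseteq> {x, y}"
    using closed by auto
  then have "card (set (map fst p)) \<le> card {x, y}"
    by (intro card_mono) auto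
  also have "\<dots> \<le> 2"
    by (simp add: card_insert_if)
  finally show False
    using distinct_card[OF dist] p(3) by simp
qed

section \<open>Copies in a transitive tournament with added edges\<close>

text \<open>
  What a copy of \<open>H\<close> in a transitive tournament leaves behind when the added edges are the reverses of a set
  \<open>S\<close> of arcs from an initial segment of vertices to its complement: \<open>L\<close> and \<open>R\<close> are the vertices placed by
  \<open>\<phi>\<close> below and above the cut, and all arcs from \<open>R\<close> to \<open>L\<close> are accounted for by \<open>S\<close>.
\<close>

definition back_arcs_embed ::
    "'a pair_pre_digraph \<Rightarrow> (nat \<times> nat) set \<Rightarrow> 'a set \<Rightarrow> 'a set \<Rightarrow> ('a \<Rightarrow> nat) \<Rightarrow> bool" where
  "back_arcs_embed H S L R \<phi> \<longleftrightarrow>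
     L \<union> R = pverts H \<and> L \<inter> R = {} \<and> transitive_set H L \<and> transitive_set H R \<and>
     inj_on \<phi> (pverts H) \<and> (\<forall>l\<in>L. \<forall>r\<in>R. (r, l) \<in> parcs H \<longrightarrow> (\<phi> l, \<phi> r) \<in> S)"

lemma contains_copyD:
  assumes "contains_copy G H"
  shows "\<exists>\<phi>. inj_on \<phi> (pverts H) \<and> (\<forall>(x, y)\<in>parcs H. (\<phi> x, \<phi> y) \<in> parcs G)"
proof -
  from assms obtain K f where K: "subgraph (with_proj K) (with_proj G)"
    and f: "pre_digraph.digraph_isomorphism (with_proj H) f" "with_proj K = app_iso f (with_proj H)"
    unfolding contains_copy_def digraph_iso_def by blast
  have arcs: "parcs K = iso_arcs f ` parcs H"
    using arg_cong[OF f(2), of arcs] by simp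
  have "iso_tail f = fst" "iso_head f = snd"
    using arg_cong[OF f(2), of tail] arg_cong[OF f(2), of head] by simp_all
  then have "iso_arcs f e = (iso_verts f (fst e), iso_verts f (snd e))" if "e \<in> parcs H" for e
    using f(1) that by (auto simp: pre_digraph.digraph_isomorphism_def prod_eq_iff)
  then have "\<forall>(x, y)\<in>parcs H. (iso_verts f x, iso_verts f y) \<in> parcs G"
    using K arcs by (force simp: subgraph_def)
  moreover have "inj_on (iso_verts f) (pverts H)"
    using f(1) by (simp add: pre_digraph.digraph_isomorphism_def)
  ultimately show ?thesis by blast
qed

text \<open>
  No added edge has both ends on the same side of \<open>m\<close>, so \<open>\<phi>\<close> is increasing along the arcs inside each side,
  which makes both sides transitive; an arc of \<open>H\<close> going down across \<open>m\<close> can only be an added edge.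
\<close>

lemma copy_embeds_back_arcs:
  assumes S: "S \<subseteq> {..<m} \<times> {m..<n}"
    and copy: "contains_copy (add_edges (transitive_tournament n) (S\<inverse>)) H"
  shows "\<exists>L R \<phi>. back_arcs_embed H S L R \<phi>"
proof -
  obtain \<phi> where inj: "inj_on \<phi> (pverts H)"
    and arcs: "\<forall>(x, y)\<in>parcs H. (\<phi> x, \<phi> y) \<in> parcs (add_edges (transitive_tournament n) (S\<inverse>))"
    using contains_copyD[OF copy] by blast
  have arc: "\<phi> x < \<phi> y \<or> (\<phi> y, \<phi> x) \<in> S" if "(x, y) \<in> parcs H" for x y
    using bspec[OF arcs that] by (auto simp: add_edges_def transitive_tournament_def)
  have incr: "\<phi> x < \<phi> y" if "(x, y) \<in> parcs H" "\<phi> x < m \<longleftrightarrow> \<phi> y < m" for x y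
    using arc[OF that(1)] S that(2) by auto
  have "transitive_set H {x \<in> pverts H. \<phi> x < m}" "transitive_set H {x \<in> pverts H. m \<le> \<phi> x}"
    by (rule transitive_setI[where \<phi> = \<phi>]; simp add: incr)+
  moreover have "(\<phi> l, \<phi> r) \<in> S" if "\<phi> l < m" "m \<le> \<phi> r" "(r, l) \<in> parcs H" for l r
    using arc[OF that(3)] that by auto
  ultimately have "back_arcs_embed H S {x \<in> pverts H. \<phi> x < m} {x \<in> pverts H. m \<le> \<phi> x} \<phi>"
    using inj by (auto simp: back_arcs_embed_def)
  then show ?thesis by blast
qed

text \<open>
  A cycle of length \<open>k \<ge> 3\<close> in the back-edge graph is carried by \<open>\<phi>\<close> to \<open>k\<close> different elements of \<open>S\<close> on at most
  \<open>k\<close> vertices, which a locally sparse \<open>S\<close> does not allow.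
\<close>

lemma back_edge_graph_cycle_image:
  assumes emb: "back_arcs_embed H S L R \<phi>" and fin: "finite (pverts H)"
    and cyc: "pre_digraph.cycle (with_proj (back_edge_graph H L R)) p" "3 \<le> length p"
  shows "\<exists>K\<subseteq>S. card K = length p \<and> card (Field K) \<le> length p \<and> length p \<le> card (pverts H)"
proof -
  obtain u where p: "pcas u p u" "distinct (map snd p)" "set p \<subseteq> parcs (back_edge_graph H L R)"
    using cyc(1) by (auto simp: cycle_with_proj_iff)
  have arc: "x \<in> L \<and> y \<in> R \<and> (\<phi> x, \<phi> y) \<in> S \<or> y \<in> L \<and> x \<in> R \<and> (\<phi> y, \<phi> x) \<in> S"
    if "(x, y) \<in> set p" for x y
    using emb p(3) that by (fastforce simp: back_edge_graph_def back_arcs_embed_def split: if_splits)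
  have LR: "L \<inter> R = {}" "L \<union> R = pverts H" and inj: "inj_on \<phi> (L \<union> R)"
    using emb by (auto simp: back_arcs_embed_def)
  \<comment> \<open>\<open>g\<close> forgets the direction of an arc: both orientations of an edge go to its image in \<open>S\<close>.\<close>
  define g where "g = (\<lambda>(x, y). if x \<in> L then (\<phi> x, \<phi> y) else (\<phi> y, \<phi> x))"
  have verts: "set (map fst p) = set (map snd p)"
    using mset_tails_eq_mset_heads[OF p(1)] by (metis add_mset_add_single add_right_imp_eq set_mset_mset)
  have "inj_on g (set p)"
  proof (rule inj_onI)
    fix e e' assume e: "e \<in> set p" "e' \<in> set p" "g e = g e'"
    obtain x y x' y' where xy: "e = (x, y)" "e' = (x', y')" by fastforce
    have "(x, y) = (x', y') \<or> (x, y) = (y', x')"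
      using e arc[of x y] arc[of x' y'] LR(1) inj unfolding xy
      by (auto simp: g_def inj_on_eq_iff split: if_splits)
    then show "e = e'"
      using cycle_no_opposite_arcs[OF p(1,2) cyc(2), of x y] e xy by auto
  qed
  then have "card (g ` set p) = length p"
    using p(2) by (simp add: card_image distinct_map distinct_card)
  moreover have "g ` set p \<subseteq> S"
    using arc LR(1) by (fastforce simp: g_def)
  moreover have "card (Field (g ` set p)) \<le> length p"
  proof -
    have "\<phi> x \<in> \<phi> ` set (map snd p) \<and> \<phi> y \<in> \<phi> ` set (map snd p)" if "(x, y) \<in> set p" for x y
      using that verts by force
    then have "g e \<in> \<phi> ` set (map snd p) \<times> \<phi> ` set (map snd p)" if "e \<in> set p" for e
      using that by (cases e) (simp add: g_def)
    then have "g ` set p \<subseteq> \<phi> ` set (map snd p) \<times> \<phi> ` set (map snd p)"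
      by blast
    then have "Field (g ` set p) \<subseteq> \<phi> ` set (map snd p)"
      unfolding Field_def by blast
    then have "card (Field (g ` set p)) \<le> card (\<phi> ` set (map snd p))"
      by (intro card_mono) auto
    also have "\<dots> \<le> length p"
      using card_image_le[of "set (map snd p)" \<phi>] distinct_card[OF p(2)] by simp
    finally show ?thesis .
  qed
  moreover have "length p \<le> card (pverts H)"
  proof -
    have "set (map snd p) \<subseteq> pverts H"
      using arc LR(2) by force
    from card_mono[OF fin this] show ?thesis
      unfolding distinct_card[OF p(2)] by simp
  qed
  ultimately show ?thesis by blast
qed

section \<open>Lower bounds for the thresholds\<close>

lemma tournament_transitive_tournament: "tournament (transitive_tournament n)"
proof unfold_locales
  show "finite (parcs (transitive_tournament n))"
    by (rule finite_subset[of _ "{..<n} \<times> {..<n}"]) (auto simp: transitive_tournament_def)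
qed (auto simp: transitive_tournament_def)

text \<open>
  The thresholds are least elements of sets of natural numbers; this shows that those sets are nonempty.
\<close>

lemma adding_forces_vacuous:
  assumes "tournament G" "card (pverts G) * card (pverts G) < t"
  shows "adding_forces G t H"
proof -
  interpret tournament G by fact
  have "parcs G \<subseteq> pverts G \<times> pverts G"
    by (auto dest: in_arcsD1 in_arcsD2)
  then have le: "card (parcs G) \<le> card (pverts G) * card (pverts G)"
    by (metis card_mono card_cartesian_product finite_cartesian_product pair_finite_verts)
  have "card S < t" if "S \<subseteq> (parcs G)\<inverse>" for S
    using card_mono[OF _ that] le assms(2) pair_finite_arcs by simp
  then show ?thesis
    unfolding adding_forces_def by blast
qed

lemma turan_transitive_le_turan_tournament: "turan_transitive n H \<le> turan_tournament n H"
proof -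
  let ?P = "\<lambda>t. \<forall>G :: nat pair_pre_digraph. tournament G \<and> card (pverts G) = n \<longrightarrow> adding_forces G t H"
  have "?P (Suc (n * n))"
    using adding_forces_vacuous by auto
  then have "?P (turan_tournament n H)"
    unfolding turan_tournament_def by (rule LeastI)
  then have "adding_forces (transitive_tournament n) (turan_tournament n H) H"
    using tournament_transitive_tournament by (simp add: transitive_tournament_def)
  then show ?thesis
    unfolding turan_transitive_def by (rule Least_le)
qed

text \<open>
  The property of forcing a copy with exactly \<open>t\<close> added edges is not visibly monotone in \<open>t\<close>. Passing to
  subsets of \<open>S\<close> rules out every \<open>t \<le> card S\<close>, not only \<open>card S\<close> itself.
\<close>

lemma card_less_turan_transitive:
  assumes S: "S \<subseteq> {..<m} \<times> {m..<n}" and free: "\<nexists>L R \<phi>. back_arcs_embed H S L R \<phi>"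
  shows "card S < turan_transitive n H"
proof (rule ccontr)
  assume "\<not> ?thesis"
  then obtain S' where S': "S' \<subseteq> S" "card S' = turan_transitive n H"
    by (meson not_less obtain_subset_with_card_n)
  have "adding_forces (transitive_tournament n) (turan_transitive n H) H"
    unfolding turan_transitive_def
    by (rule LeastI[where P = "\<lambda>t. adding_forces _ t H"],
        rule adding_forces_vacuous[OF tournament_transitive_tournament lessI])
  moreover have "S'\<inverse> \<subseteq> (parcs (transitive_tournament n))\<inverse>"
    using S S'(1) by (fastforce simp: transitive_tournament_def)
  ultimately have "contains_copy (add_edges (transitive_tournament n) (S'\<inverse>)) H"
    using S'(2) by (simp add: adding_forces_def)
  moreover have "S' \<subseteq> {..<m} \<times> {m..<n}"
    using S S'(1) by blast
  ultimately obtain L R \<phi> where "back_arcs_embed H S' L R \<phi>"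
    using copy_embeds_back_arcs by blast
  then have "back_arcs_embed H S L R \<phi>"
    using S'(1) unfolding back_arcs_embed_def by blast
  then show False
    using free by blast
qed

text \<open>
  If the back arcs of \<open>H\<close> contain a small dense graph, whichever way \<open>H\<close> is cut into two transitive sets, then
  adding the reverses of a locally sparse graph creates no copy of \<open>H\<close>.
\<close>

lemma turan_transitive_bigomega:
  fixes \<theta> :: real
  assumes "\<theta> > 0"
    and dense: "\<And>S L R \<phi>. back_arcs_embed H S L R \<phi> \<Longrightarrow>
      \<exists>K\<subseteq>S. 2 \<le> card K \<and> card (Field K) \<le> h \<and>
        real (card (Field K)) - 2 \<le> \<theta> * (real (card K) - 1)"
  shows "(\<lambda>n. real (turan_transitive n H)) \<in> \<Omega>(\<lambda>n. real n powr (2 - \<theta>))"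
proof -
  obtain c where "c > 0" and c: "\<And>n. n \<ge> 2 \<Longrightarrow> \<exists>S \<subseteq> {..<n div 2} \<times> {n div 2..<n}.
      c * real n powr (2 - \<theta>) \<le> real (card S) \<and>
      (\<forall>K\<subseteq>S. 2 \<le> card K \<longrightarrow> card (Field K) \<le> h \<longrightarrow>
         \<theta> * (real (card K) - 1) < real (card (Field K)) - 2)"
    using sparse_bipartite_graph[OF \<open>\<theta> > 0\<close>, of h] by blast
  have "c * real n powr (2 - \<theta>) \<le> real (turan_transitive n H)" if "n \<ge> 2" for n
  proof -
    obtain S where S: "S \<subseteq> {..<n div 2} \<times> {n div 2..<n}" "c * real n powr (2 - \<theta>) \<le> real (card S)"
      and sparse: "\<And>K. K \<subseteq> S \<Longrightarrow> 2 \<le> card K \<Longrightarrow> card (Field K) \<le> h \<Longrightarrow>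
         \<theta> * (real (card K) - 1) < real (card (Field K)) - 2"
      using c[OF \<open>n \<ge> 2\<close>] by blast
    have "\<nexists>L R \<phi>. back_arcs_embed H S L R \<phi>"
      using dense sparse by (meson not_less)
    then have "card S < turan_transitive n H"
      using S(1) by (rule card_less_turan_transitive[rotated])
    with S(2) show ?thesis by linarith
  qed
  then show ?thesis
    using \<open>c > 0\<close> by (intro landau_omega.bigI[of c] eventually_mono[OF eventually_ge_at_top[of 2]]) auto
qed

text \<open>
  For a cycle of length \<open>k \<le> h\<close>, the density condition \<open>k - 2 \<le> \<theta> * (k - 1)\<close> holds for \<open>\<theta> = 1 - 1 / h\<close>. This is
  where the exponent \<open>2 - \<theta> = 1 + 1 / h\<close> comes from; adding \<open>2\<close> to the number of vertices ensures \<open>\<theta> > 0\<close>.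
\<close>

lemma turan_transitive_of_nonforest:
  assumes H: "tournament H" "\<not> tournament_forest H"
  shows "(\<lambda>n. real (turan_transitive n H)) \<in>
    \<Omega>(\<lambda>n. real n powr (1 + 1 / real (card (pverts H) + 2)))"
proof -
  define h where "h = card (pverts H) + 2"
  define \<theta> where "\<theta> = 1 - 1 / real h"
  have "h \<ge> 2" by (simp add: h_def)
  then have "\<theta> > 0" by (simp add: \<theta>_def)
  interpret tournament H by fact
  have "(\<lambda>n. real (turan_transitive n H)) \<in> \<Omega>(\<lambda>n. real n powr (2 - \<theta>))"
  proof (rule turan_transitive_bigomega[OF \<open>\<theta> > 0\<close>, where h = h])
    fix S L R \<phi> assume emb: "back_arcs_embed H S L R \<phi>"
    then have "\<not> undirected_forest (back_edge_graph H L R)"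
      using H unfolding tournament_forest_def back_arcs_embed_def by blast
    then obtain p where p: "pre_digraph.cycle (with_proj (back_edge_graph H L R)) p" "3 \<le> length p"
      unfolding undirected_forest_def by blast
    obtain K where "K \<subseteq> S" "card K = length p" "card (Field K) \<le> length p"
      "length p \<le> card (pverts H)"
      using back_edge_graph_cycle_image[OF emb pair_finite_verts p] by blast
    then have K: "K \<subseteq> S" "card K \<ge> 3" "card (Field K) \<le> card K" "card K \<le> h"
      using p(2) by (simp_all add: h_def)
    have "(real (card K) - 1) / real h \<le> 1"
      using K \<open>h \<ge> 2\<close> by simp
    then have "real (card K) - 2 \<le> \<theta> * (real (card K) - 1)"
      by (simp add: \<theta>_def algebra_simps diff_divide_distrib)
    then have "real (card (Field K)) - 2 \<le> \<theta> * (real (card K) - 1)"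
      using K(3) by linarith
    with K show "\<exists>K\<subseteq>S. 2 \<le> card K \<and> card (Field K) \<le> h \<and>
        real (card (Field K)) - 2 \<le> \<theta> * (real (card K) - 1)"
      by (intro exI[of _ K]) auto
  qed
  then show ?thesis
    by (simp add: \<theta>_def h_def)
qed

section \<open>The blown-up cyclic triangle\<close>

text \<open>
  The cyclic triangle with each vertex replaced by a transitive tournament on \<open>N\<close> vertices; the quotient
  \<open>x div N\<close> is the triangle vertex that \<open>x\<close> comes from.
\<close>

definition blown_up_triangle :: "nat \<Rightarrow> nat pair_pre_digraph" where
  "blown_up_triangle N = \<lparr>pverts = {..<3 * N},
     parcs = {(x, y). x < 3 * N \<and> y < 3 * N \<and>
       (y div N = Suc (x div N) mod 3 \<or> x div N = y div N \<and> x < y)}\<rparr>"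

definition block :: "nat \<Rightarrow> nat \<Rightarrow> nat set" where
  "block N i = {i * N..<Suc i * N}"

lemma mem_block_iff:
  assumes "N > 0"
  shows "x \<in> block N i \<longleftrightarrow> x div N = i"
  using div_nat_eqI[of N i x] div_times_less_eq_dividend[of x N] dividend_less_div_times[OF assms, of x]
  by (auto simp: block_def algebra_simps)

lemma block_subset:
  assumes "i < 3"
  shows "block N i \<subseteq> pverts (blown_up_triangle N)"
proof
  fix x assume "x \<in> block N i"
  then have "x < Suc i * N"
    unfolding block_def by simp
  also have "\<dots> \<le> 3 * N"
    using assms by (intro mult_le_mono1) simp
  finally show "x \<in> pverts (blown_up_triangle N)"
    by (simp add: blown_up_triangle_def)
qed

lemma card_block: "card (block N i) = N"
  by (simp add: block_def)

lemma blown_up_triangle_arcI: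
  assumes "N > 0" "i < 3" "x \<in> block N i" "y \<in> block N (Suc i mod 3)"
  shows "(x, y) \<in> parcs (blown_up_triangle N)"
proof -
  have "x \<in> pverts (blown_up_triangle N)" "y \<in> pverts (blown_up_triangle N)"
    using block_subset[of i N] block_subset[of "Suc i mod 3" N] assms by auto
  then show ?thesis
    using assms by (simp add: blown_up_triangle_def mem_block_iff)
qed

lemma tournament_blown_up_triangle:
  assumes "N > 0"
  shows "tournament (blown_up_triangle N)"
proof unfold_locales
  show "finite (parcs (blown_up_triangle N))"
    by (rule finite_subset[of _ "{..<3 * N} \<times> {..<3 * N}"]) (auto simp: blown_up_triangle_def)
next
  fix u v assume uv: "u \<in> pverts (blown_up_triangle N)" "v \<in> pverts (blown_up_triangle N)" "u \<noteq> v"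
  then have "u div N < 3" "v div N < 3"
    by (simp_all add: blown_up_triangle_def less_mult_imp_div_less)
  moreover have "(j = Suc i mod 3 \<or> i = j \<and> u < v) \<longleftrightarrow> \<not> (i = Suc j mod 3 \<or> j = i \<and> v < u)"
    if "i < 3" "j < 3" for i j
  proof -
    have "i = 0 \<or> i = 1 \<or> i = 2" "j = 0 \<or> j = 1 \<or> j = 2"
      using that by linarith+
    moreover have "u < v \<longleftrightarrow> \<not> v < u"
      using \<open>u \<noteq> v\<close> by linarith
    ultimately show ?thesis
      by (elim disjE) simp_all
  qed
  ultimately show "(u, v) \<in> parcs (blown_up_triangle N) \<longleftrightarrow> (v, u) \<notin> parcs (blown_up_triangle N)"
    using uv(1,2) by (simp add: blown_up_triangle_def)
next
  have "k \<noteq> Suc k mod 3" for k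
    by presburger
  then have "(x, x) \<notin> parcs (blown_up_triangle N)" for x
    by (simp add: blown_up_triangle_def)
  then show "fst e \<noteq> snd e" if "e \<in> parcs (blown_up_triangle N)" for e
    using that by (metis prod.collapse)
qed (auto simp: blown_up_triangle_def)

text \<open>
  One vertex from each block would form a cyclic triangle.
\<close>

lemma transitive_set_misses_block:
  assumes "N > 0" "transitive_set (blown_up_triangle N) T"
  shows "\<exists>i<3. T \<inter> block N i = {}"
proof (rule ccontr)
  assume "\<not> ?thesis"
  then have "\<And>i. i < 3 \<Longrightarrow> \<exists>x. x \<in> T \<inter> block N i"
    by auto
  from this[of 0] this[of 1] this[of 2] obtain x y z where
    xyz: "x \<in> T" "x \<in> block N 0" "y \<in> T" "y \<in> block N 1" "z \<in> T" "z \<in> block N 2"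
    by auto
  have "(x, y) \<in> parcs (blown_up_triangle N)" "(y, z) \<in> parcs (blown_up_triangle N)"
    "(z, x) \<in> parcs (blown_up_triangle N)"
    using blown_up_triangle_arcI[OF \<open>N > 0\<close>, of 0 x y] blown_up_triangle_arcI[OF \<open>N > 0\<close>, of 1 y z]
      blown_up_triangle_arcI[OF \<open>N > 0\<close>, of 2 z x] xyz by (simp_all add: numeral_2_eq_2)
  moreover have "x \<noteq> y" "y \<noteq> z" "z \<noteq> x"
    using xyz by (auto simp: mem_block_iff[OF \<open>N > 0\<close>])
  ultimately show False
    using transitive_set_no_triangle[OF assms(2)] xyz by blast
qed

lemma chromatic_number_blown_up_triangle:
  assumes "N > 0"
  shows "chromatic_number (blown_up_triangle N) = 2"
  unfolding chromatic_number_def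
proof (rule Least_equality)
  let ?H = "blown_up_triangle N"
  let ?A = "{..<2 * N}" and ?B = "{2 * N..<3 * N}"
  have "transitive_set ?H ?A"
  proof (rule transitive_setI[where \<phi> = id])
    fix x y assume xy: "x \<in> ?A" "y \<in> ?A" "(x, y) \<in> parcs ?H"
    then have "x div N < 2" "y div N < 2"
      by (auto simp: less_mult_imp_div_less)
    with xy(3) have "x div N < y div N \<or> x < y"
      by (auto simp: blown_up_triangle_def)
    then show "id x < id y"
      by (metis div_le_mono id_apply not_less)
  qed (auto simp: blown_up_triangle_def)
  moreover have "transitive_set ?H ?B"
  proof (rule transitive_setI[where \<phi> = id])
    fix x y assume xy: "x \<in> ?B" "y \<in> ?B" "(x, y) \<in> parcs ?H"
    then have "x div N = 2" "y div N = 2"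
      by (auto simp: div_nat_eqI)
    with xy(3) show "id x < id y"
      by (auto simp: blown_up_triangle_def)
  qed (auto simp: blown_up_triangle_def)
  moreover have "?A \<noteq> {}" "?B \<noteq> {}"
    using assms by (auto simp: lessThan_empty_iff)
  then have "partition_on (pverts ?H) {?A, ?B}"
    by (auto simp: partition_on_def blown_up_triangle_def disjoint_def)
  moreover have "card {?A, ?B} = 2"
  proof -
    have "0 \<in> ?A" "0 \<notin> ?B"
      using assms by auto
    then have "?A \<noteq> ?B"
      by metis
    then show ?thesis
      by simp
  qed
  ultimately show "\<exists>P. partition_on (pverts ?H) P \<and> card P = 2 \<and> (\<forall>S\<in>P. transitive_set ?H S)"
    by (intro exI[of _ "{?A, ?B}"]) simp
next
  let ?H = "blown_up_triangle N"
  fix k assume "\<exists>P. partition_on (pverts ?H) P \<and> card P = k \<and> (\<forall>S\<in>P. transitive_set ?H S)"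
  then obtain P where P: "partition_on (pverts ?H) P" "card P = k" "\<And>S. S \<in> P \<Longrightarrow> transitive_set ?H S"
    by blast
  have "finite P"
    using finite_elements[OF _ P(1)] by (simp add: blown_up_triangle_def)
  have "pverts ?H \<noteq> {}"
    using assms by (simp add: blown_up_triangle_def lessThan_empty_iff)
  then have "P \<noteq> {}"
    using P(1) by (auto simp: partition_on_def)
  have "\<not> transitive_set ?H (pverts ?H)"
  proof
    assume "transitive_set ?H (pverts ?H)"
    then obtain i where "i < 3" "pverts ?H \<inter> block N i = {}"
      using transitive_set_misses_block[OF assms] by blast
    then have "block N i = {}"
      using block_subset by blast
    then show False
      using card_block[of N i] assms by simp
  qed
  then have "k \<noteq> 1"
    using P by (auto simp: card_1_singleton_iff partition_on_def)
  moreover have "k \<noteq> 0"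
    using P(2) \<open>finite P\<close> \<open>P \<noteq> {}\<close> by auto
  ultimately show "2 \<le> k"
    by simp
qed

text \<open>
  Both \<open>L\<close> and \<open>R\<close> miss a block, so \<open>R\<close> contains a block \<open>i\<close> and \<open>L\<close> contains another block \<open>j\<close>. If all arcs
  between them lead from \<open>i\<close> to \<open>j\<close>, they already go from \<open>R\<close> to \<open>L\<close>. Otherwise the third block \<open>k\<close> receives all
  arcs from \<open>i\<close> and sends all arcs to \<open>j\<close>; one of \<open>L\<close> and \<open>R\<close> contains half of it, and that half forms a
  complete bipartite graph of back arcs with block \<open>i\<close> or with block \<open>j\<close>, respectively.
\<close>

lemma blown_up_triangle_biclique:
  assumes "s > 0" and T: "transitive_set (blown_up_triangle (2 * s)) L" "transitive_set (blown_up_triangle (2 * s)) R"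
    and LR: "L \<union> R = pverts (blown_up_triangle (2 * s))" "L \<inter> R = {}"
  shows "\<exists>A\<subseteq>L. \<exists>B\<subseteq>R. card A = s \<and> card B = s \<and>
    (\<forall>a\<in>A. \<forall>b\<in>B. (b, a) \<in> parcs (blown_up_triangle (2 * s)))"
proof -
  let ?N = "2 * s" and ?H = "blown_up_triangle (2 * s)"
  have N: "?N > 0" using \<open>s > 0\<close> by simp
  have pick: ?thesis
    if XY: "X \<subseteq> L" "Y \<subseteq> R" "s \<le> card X" "s \<le> card Y" "i < 3" "Y \<subseteq> block ?N i" "X \<subseteq> block ?N (Suc i mod 3)"
    for X Y i
  proof -
    obtain A where A: "A \<subseteq> X" "card A = s"
      by (rule obtain_subset_with_card_n[OF XY(3)])
    obtain B where B: "B \<subseteq> Y" "card B = s"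
      by (rule obtain_subset_with_card_n[OF XY(4)])
    have "(b, a) \<in> parcs ?H" if "a \<in> A" "b \<in> B" for a b
      using that A(1) B(1) XY(6,7) by (intro blown_up_triangle_arcI[OF N \<open>i < 3\<close>]) blast+
    moreover have "A \<subseteq> L" "B \<subseteq> R"
      using A(1) B(1) XY(1,2) by simp_all
    ultimately show ?thesis
      using A(2) B(2) by blast
  qed
  obtain i where i: "i < 3" "L \<inter> block ?N i = {}"
    using transitive_set_misses_block[OF N T(1)] by blast
  obtain j where j: "j < 3" "R \<inter> block ?N j = {}"
    using transitive_set_misses_block[OF N T(2)] by blast
  have sub: "block ?N i \<subseteq> R" "block ?N j \<subseteq> L"
    using i j LR block_subset[OF i(1), of ?N] block_subset[OF j(1), of ?N] by blast+
  have "block ?N i \<noteq> {}"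
    using card_block[of ?N i] N by force
  then have "i \<noteq> j"
    using sub LR(2) by auto
  moreover have "i = 0 \<or> i = 1 \<or> i = 2" "j = 0 \<or> j = 1 \<or> j = 2"
    using i(1) j(1) by linarith+
  ultimately have "j = Suc i mod 3 \<or> j = Suc (Suc i mod 3) mod 3"
    by (elim disjE) simp_all
  then consider "j = Suc i mod 3" | "j = Suc (Suc i mod 3) mod 3"
    by blast
  then show ?thesis
  proof cases
    case 1
    then show ?thesis
      using pick[of "block ?N j" "block ?N i" i] sub i by (simp add: card_block)
  next
    case 2
    let ?k = "Suc i mod 3"
    have "block ?N ?k = (block ?N ?k \<inter> L) \<union> (block ?N ?k \<inter> R)"
      using block_subset[of ?k ?N] LR(1) by auto
    then have "?N \<le> card (block ?N ?k \<inter> L) + card (block ?N ?k \<inter> R)"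
      by (metis card_Un_le card_block)
    then consider "s \<le> card (block ?N ?k \<inter> L)" | "s \<le> card (block ?N ?k \<inter> R)"
      by linarith
    then show ?thesis
    proof cases
      case 1
      then show ?thesis
        using pick[of "block ?N ?k \<inter> L" "block ?N i" i] sub i by (simp add: card_block)
    next
      assume "s \<le> card (block ?N ?k \<inter> R)"
      then show ?thesis
        using pick[of "block ?N j" "block ?N ?k \<inter> R" ?k] sub i 2 by (simp add: card_block)
    qed
  qed
qed

text \<open>
  The complete bipartite graph with parts of size \<open>s\<close> has \<open>2 * s\<close> vertices and \<open>s * s\<close> edges, and
  \<open>2 * s - 2 \<le> \<theta> * (s * s - 1)\<close> amounts to \<open>2 \<le> \<theta> * (s + 1)\<close> after division by \<open>s - 1\<close>.
\<close>

lemma turan_transitive_blown_up_triangle: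
  fixes \<theta> :: real
  assumes "\<theta> > 0" "s \<ge> 2" "2 \<le> \<theta> * real (s + 1)"
  shows "(\<lambda>n. real (turan_transitive n (blown_up_triangle (2 * s)))) \<in> \<Omega>(\<lambda>n. real n powr (2 - \<theta>))"
proof (rule turan_transitive_bigomega[OF \<open>\<theta> > 0\<close>, where h = "2 * s"])
  let ?H = "blown_up_triangle (2 * s)"
  fix S L R \<phi> assume emb: "back_arcs_embed ?H S L R \<phi>"
  then obtain A B where AB: "A \<subseteq> L" "B \<subseteq> R" "card A = s" "card B = s"
    "\<forall>a\<in>A. \<forall>b\<in>B. (b, a) \<in> parcs ?H"
    using blown_up_triangle_biclique[of s L R] assms(2) unfolding back_arcs_embed_def by auto
  let ?K = "\<phi> ` A \<times> \<phi> ` B"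
  have inj: "inj_on \<phi> A" "inj_on \<phi> B"
    using emb AB(1,2) unfolding back_arcs_embed_def by (metis Un_upper1 Un_upper2 inj_on_subset)+
  have "?K \<subseteq> S"
    using emb AB(1,2,5) unfolding back_arcs_embed_def by blast
  moreover have cardK: "card ?K = s * s"
    using AB inj by (simp add: card_cartesian_product card_image)
  moreover have "2 * 1 \<le> s * s"
    using assms(2) by (intro mult_mono) auto
  moreover have cardField: "card (Field ?K) \<le> 2 * s"
  proof -
    have fin: "finite A" "finite B"
      using AB assms(2) by (auto intro: card_ge_0_finite)
    then have "card (Field ?K) \<le> card (\<phi> ` A \<union> \<phi> ` B)"
      by (intro card_mono) (auto simp: Field_def)
    also have "\<dots> \<le> s + s"
      using card_Un_le[of "\<phi> ` A" "\<phi> ` B"] AB inj by (simp add: card_image)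
    finally show ?thesis by simp
  qed
  moreover have "real (card (Field ?K)) - 2 \<le> \<theta> * (real (card ?K) - 1)"
  proof -
    have "real (card (Field ?K)) \<le> real (2 * s)"
      using cardField by (rule of_nat_mono)
    then have "real (card (Field ?K)) - 2 \<le> 2 * (real s - 1)"
      unfolding of_nat_mult of_nat_numeral by argo
    also have "\<dots> \<le> \<theta> * real (s + 1) * (real s - 1)"
      using assms by (intro mult_right_mono) auto
    also have "\<dots> = \<theta> * (real (card ?K) - 1)"
      by (simp add: cardK algebra_simps)
    finally show ?thesis .
  qed
  ultimately show "\<exists>K\<subseteq>S. 2 \<le> card K \<and> card (Field K) \<le> 2 * s \<and>
      real (card (Field K)) - 2 \<le> \<theta> * (real (card K) - 1)"
    by (intro exI[of _ ?K]) simp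
qed

section \<open>Superlinear and almost quadratic thresholds\<close>

theorem proposition1p4:
  shows
    "(\<forall>H :: 'a pair_pre_digraph. tournament H \<longrightarrow> \<not> tournament_forest H \<longrightarrow>
        (\<exists>c :: real. c > 0 \<and>
           (\<forall>n \<ge> card (pverts H). turan_tournament n H \<ge> turan_transitive n H) \<and>
           (\<lambda>n. real (turan_transitive n H)) \<in> \<Omega>(\<lambda>n. real n powr (1 + c))))
     \<and>
     (\<forall>\<epsilon> :: real. \<epsilon> > 0 \<longrightarrow>
        (\<exists>H :: nat pair_pre_digraph. tournament H \<and> chromatic_number H = 2 \<and>
           (\<lambda>n. real (turan_transitive n H)) \<in> \<Omega>(\<lambda>n. real n powr (2 - \<epsilon>))))"
proof (intro conjI allI impI)
  fix H :: "'a pair_pre_digraph"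
  assume "tournament H" "\<not> tournament_forest H"
  then show "\<exists>c :: real. c > 0 \<and>
      (\<forall>n \<ge> card (pverts H). turan_tournament n H \<ge> turan_transitive n H) \<and>
      (\<lambda>n. real (turan_transitive n H)) \<in> \<Omega>(\<lambda>n. real n powr (1 + c))"
    using turan_transitive_of_nonforest turan_transitive_le_turan_tournament
    by (intro exI[of _ "1 / real (card (pverts H) + 2)"]) auto
next
  fix \<epsilon> :: real
  assume "\<epsilon> > 0"
  define s where "s = nat \<lceil>2 / \<epsilon>\<rceil> + 2"
  have "2 / \<epsilon> \<le> real (s + 1)"
    unfolding s_def by linarith
  then have "2 \<le> \<epsilon> * real (s + 1)"
    using \<open>\<epsilon> > 0\<close> by (simp add: field_simps)
  moreover have "s \<ge> 2"
    by (simp add: s_def)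
  ultimately show "\<exists>H :: nat pair_pre_digraph. tournament H \<and> chromatic_number H = 2 \<and>
      (\<lambda>n. real (turan_transitive n H)) \<in> \<Omega>(\<lambda>n. real n powr (2 - \<epsilon>))"
    using \<open>\<epsilon> > 0\<close>
    by (intro exI[of _ "blown_up_triangle (2 * s)"] conjI tournament_blown_up_triangle
        chromatic_number_blown_up_triangle turan_transitive_blown_up_triangle) auto
qed

end
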